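(* Let $\mathcal U$ be a complex Banach space, $\Psi=(\psi,s)$ an arbitrary finitary evolution in $\mathcal U$, $\mathcal F$ a normed vector space, and $f:\mathcal U\to\mathcal F$ a sampling function, i.e. a continuous linear map. Put $f_t=f(\psi^t s)$ and $\overline f_t=\frac1t\sum_{m=1}^t f_m$ for $t=1,2,\dots$. Then the following statements are equivalent: (i) the sampling averages $\overline f_t$ converge (in the norm of $\mathcal F$) as $t\to\infty$; (ii) the sampling values $f_t$ are bounded in norm.
   Context: An evolution $\Psi=(\psi,s)$ in $\mathcal U$ consists of a linear operator $\psi$ on $\mathcal U$ and a vector $s\in\mathcal U$, and is identified with the sequence $(\psi^t s)_{t\ge 0}$. It is finite-dimensional if $\mathrm{lin}\{\psi^t s\mid t\ge0\}$ (linear span) is finite-dimensional. Two evolutions $(\varphi,v)$ and $(\psi,w)$ in $\mathcal U$ are equivalent if $\lim_{t\to\infty}\|\psi^t w-\varphi^t v\|=0$. $\Psi$ is finitary if it is equivalent to a finite-dimensional evolution in $\mathcal U$. *)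

theory Defs
  imports "HOL-Analysis.Analysis"
begin

text \<open>
  The library has no class of complex normed spaces. The classes below extend the real ones,
  so that norm, topology, limits and completeness are the library's; the real scaling is
  required to be the restriction of the complex one.
\<close>

class scaleC = scaleR +
  fixes scaleC :: "complex \<Rightarrow> 'a \<Rightarrow> 'a"  (infixr "*\<^sub>C" 75)
  assumes scaleR_scaleC: "r *\<^sub>R x = complex_of_real r *\<^sub>C x"

class complex_vector = scaleC + ab_group_add +
  assumes scaleC_add_right: "a *\<^sub>C (x + y) = a *\<^sub>C x + a *\<^sub>C y"
    and scaleC_add_left: "(a + b) *\<^sub>C x = a *\<^sub>C x + b *\<^sub>C x"
    and scaleC_scaleC: "a *\<^sub>C b *\<^sub>C x = (a * b) *\<^sub>C x"
    and scaleC_one: "1 *\<^sub>C x = x"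

class complex_normed_vector = complex_vector + real_normed_vector +
  assumes norm_scaleC: "norm (a *\<^sub>C x) = cmod a * norm x"

class complex_banach = complex_normed_vector + banach

instantiation complex :: complex_banach
begin

definition scaleC_complex :: "complex \<Rightarrow> complex \<Rightarrow> complex"
  where "scaleC_complex a x = a * x"

instance
  by standard (simp_all add: scaleC_complex_def scaleR_conv_of_real algebra_simps norm_mult)

end

global_interpretation complex_vector:
  vector_space "scaleC :: complex \<Rightarrow> 'a \<Rightarrow> 'a :: complex_vector"
  by unfold_locales (simp_all add: scaleC_add_right scaleC_add_left scaleC_scaleC scaleC_one)

abbreviation clinear :: "('a::complex_vector \<Rightarrow> 'b::complex_vector) \<Rightarrow> bool"
  where "clinear \<equiv> Vector_Spaces.linear scaleC scaleC"

abbreviation cspan :: "'a::complex_vector set \<Rightarrow> 'a set"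
  where "cspan \<equiv> module.span scaleC"

definition finite_dim_subspace :: "'a::complex_vector set \<Rightarrow> bool"
  where "finite_dim_subspace V \<longleftrightarrow>
    (\<exists>B. finite B \<and> \<not> module.dependent scaleC B \<and> cspan B = V)"

text \<open>The operator of an evolution is not required to be bounded.\<close>

type_synonym 'u evolution = "('u \<Rightarrow> 'u) \<times> 'u"

definition is_evolution :: "'u::complex_vector evolution \<Rightarrow> bool"
  where "is_evolution \<Psi> \<longleftrightarrow> clinear (fst \<Psi>)"

definition orbit :: "'u evolution \<Rightarrow> nat \<Rightarrow> 'u"
  where "orbit \<Psi> t = (fst \<Psi> ^^ t) (snd \<Psi>)"

definition finite_dim_evolution :: "'u::complex_vector evolution \<Rightarrow> bool"
  where "finite_dim_evolution \<Psi> \<longleftrightarrow>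
    is_evolution \<Psi> \<and> finite_dim_subspace (cspan {orbit \<Psi> t |t. t \<ge> 0})"

definition equivalent :: "'u::complex_normed_vector evolution \<Rightarrow> 'u evolution \<Rightarrow> bool"
  where "equivalent \<Phi> \<Psi> \<longleftrightarrow> (\<lambda>t. norm (orbit \<Psi> t - orbit \<Phi> t)) \<longlonglongrightarrow> 0"

definition finitary :: "'u::complex_normed_vector evolution \<Rightarrow> bool"
  where "finitary \<Psi> \<longleftrightarrow>
    is_evolution \<Psi> \<and> (\<exists>\<Phi>. finite_dim_evolution \<Phi> \<and> equivalent \<Psi> \<Phi>)"

definition sampling_function ::
    "('u::complex_normed_vector \<Rightarrow> 'f::complex_normed_vector) \<Rightarrow> bool"
  where "sampling_function f \<longleftrightarrow> clinear f \<and> continuous_on UNIV f"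

definition sampling_value :: "('u \<Rightarrow> 'f) \<Rightarrow> 'u evolution \<Rightarrow> nat \<Rightarrow> 'f"
  where "sampling_value f \<Psi> t = f (orbit \<Psi> t)"

definition sampling_average ::
    "('u \<Rightarrow> 'f::real_vector) \<Rightarrow> 'u evolution \<Rightarrow> nat \<Rightarrow> 'f"
  where "sampling_average f \<Psi> t = (1 / real t) *\<^sub>R (\<Sum>m=1..t. sampling_value f \<Psi> m)"

end

theory Submission
  imports Defs "HOL-Computational_Algebra.Fundamental_Theorem_Algebra"
begin

text \<open>
  The sampling values of the equivalent finite-dimensional evolution satisfy a linear recurrence
  with characteristic polynomial $p \<noteq> 0$, and they differ from $f_t$ by a null sequence. Both
  conditions force $f_t = o(t)$. Splitting $1$ by Bezout between a power of one root of $p$ and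
  the cofactor writes the recurrent sequence as a sum of sequences, each annihilated by
  $(S - a)^k$ with $S$ the shift; these are images of the original sequence under polynomials
  in $S$, so growth $o(t)$ is inherited. For such a sequence, growth $o(t)$ leaves only a null sequence
  ($|a| < 1$), a multiple of $a^t$ ($|a| = 1$) or zero ($|a| > 1$), and each of these is bounded
  with convergent averages.
\<close>

section \<open>Polynomials in the shift operator\<close>

definition poly_shift :: "complex poly \<Rightarrow> (nat \<Rightarrow> 'a::complex_vector) \<Rightarrow> nat \<Rightarrow> 'a"
  where "poly_shift p g t = (\<Sum>i\<le>degree p. coeff p i *\<^sub>C g (t + i))"

lemma poly_shift_0 [simp]: "poly_shift 0 g t = 0"
  by (simp add: poly_shift_def)

lemma poly_shift_pCons [simp]:
  "poly_shift (pCons a p) g t = a *\<^sub>C g t + poly_shift p g (Suc t)"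
proof (cases "p = 0")
  case False
  then show ?thesis
    by (simp add: poly_shift_def sum.atMost_Suc_shift del: sum.atMost_Suc)
qed (simp add: poly_shift_def)

lemma poly_shift_add: "poly_shift (p + q) g t = poly_shift p g t + poly_shift q g t"
  by (induction p q arbitrary: t rule: poly_induct2)
    (simp_all add: scaleC_add_left algebra_simps)

lemma poly_shift_smult: "poly_shift (smult a p) g t = a *\<^sub>C poly_shift p g t"
  by (induction p arbitrary: t) (simp_all add: scaleC_add_right scaleC_scaleC)

text \<open>Evaluation at the shift is a ring action: products become compositions, and
  commutativity of \<open>*\<close> lets factors be reordered.\<close>

lemma poly_shift_mult: "poly_shift (p * q) g t = poly_shift p (poly_shift q g) t"
  by (induction p arbitrary: t) (simp_all add: poly_shift_add poly_shift_smult)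

lemma poly_shift_1 [simp]: "poly_shift 1 g t = g t"
  by (simp add: one_pCons)

lemma poly_shift_seq_0: "(\<And>t. g t = 0) \<Longrightarrow> poly_shift p g t = 0"
  by (simp add: poly_shift_def)

section \<open>Growth slower than t\<close>

definition sublinear :: "(nat \<Rightarrow> 'a::real_normed_vector) \<Rightarrow> bool"
  where "sublinear g \<longleftrightarrow> (\<lambda>t. (1 / real t) *\<^sub>R g t) \<longlonglongrightarrow> 0"

lemma sublinear_add: "sublinear g \<Longrightarrow> sublinear h \<Longrightarrow> sublinear (\<lambda>t. g t + h t)"
  unfolding sublinear_def using tendsto_add[of _ 0 _ _ 0] by (force simp: scaleR_add_right)

lemma sublinear_scaleC:
  fixes g :: "nat \<Rightarrow> 'a::complex_normed_vector"
  assumes "sublinear g"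
  shows "sublinear (\<lambda>t. a *\<^sub>C g t)"
proof -
  have "(\<lambda>t. cmod a * norm ((1 / real t) *\<^sub>R g t)) \<longlonglongrightarrow> 0"
    using assms unfolding sublinear_def
    by (intro tendsto_mult_right_zero tendsto_norm_zero)
  then show ?thesis
    unfolding sublinear_def
    by (intro tendsto_norm_zero_cancel[of "\<lambda>t. (1 / real t) *\<^sub>R a *\<^sub>C g t"])
      (simp add: norm_scaleC mult_ac)
qed

lemma sublinear_Suc:
  assumes "sublinear g"
  shows "sublinear (\<lambda>t. g (Suc t))"
proof -
  \<comment> \<open>The factor (t + 1) / t tends to 1. At t = 0 division by 0 gives 0, so cancelling
    \<open>Suc t\<close> leaves the required term there too.\<close>
  have "(\<lambda>t. (real (Suc t) / real t) *\<^sub>R (1 / real (Suc t)) *\<^sub>R g (Suc t)) \<longlonglongrightarrow> 1 *\<^sub>R 0"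
    using assms unfolding sublinear_def
    by (intro tendsto_scaleR LIMSEQ_Suc[of "\<lambda>t. (1 / real t) *\<^sub>R g t"] LIMSEQ_Suc_n_over_n)
  then show ?thesis
    unfolding sublinear_def by (simp del: of_nat_Suc)
qed

text \<open>Closure under scaling, addition and the shift suffices, by induction on the
  coefficients.\<close>

lemma sublinear_poly_shift:
  fixes g :: "nat \<Rightarrow> 'a::complex_normed_vector"
  shows "sublinear g \<Longrightarrow> sublinear (poly_shift p g)"
proof (induction p)
  case 0
  then show ?case by (simp add: sublinear_def)
next
  case (pCons a p)
  then have "sublinear (\<lambda>t. a *\<^sub>C g t + poly_shift p g (Suc t))"
    by (intro sublinear_add sublinear_scaleC sublinear_Suc)
  then show ?case by (simp add: sublinear_def)
qed

lemma Bseq_imp_sublinear: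
  assumes "Bseq g"
  shows "sublinear g"
proof -
  have "(\<lambda>t. 1 / real t) \<longlonglongrightarrow> 0"
    by (rule lim_1_over_n)
  moreover have "Bfun g sequentially"
    using assms .
  ultimately show ?thesis
    unfolding sublinear_def
    using bounded_bilinear.Zfun_prod_Bfun[OF bounded_bilinear_scaleR, of "\<lambda>t. 1 / real t" sequentially g]
    by (simp add: tendsto_Zfun_iff)
qed

section \<open>Cesaro averages\<close>

definition average :: "(nat \<Rightarrow> 'a::real_normed_vector) \<Rightarrow> nat \<Rightarrow> 'a"
  where "average g t = (1 / real t) *\<^sub>R (\<Sum>m=1..t. g m)"

lemma average_add: "average (\<lambda>t. g t + h t) t = average g t + average h t"
  by (simp add: average_def sum.distrib scaleR_add_right)

lemma average_null:
  assumes "g \<longlonglongrightarrow> 0"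
  shows "average g \<longlonglongrightarrow> 0"
proof (rule LIMSEQ_I)
  fix e :: real
  assume "e > 0"
  then obtain N where N: "\<And>m. m \<ge> N \<Longrightarrow> norm (g m) < e / 2"
    using LIMSEQ_D[OF assms, of "e / 2"] by auto
  \<comment> \<open>The first N terms contribute at most C in norm; beyond M this is less than half
    of t e.\<close>
  define C where "C = (\<Sum>m\<in>{1..N}. norm (g m))"
  have "C \<ge> 0"
    by (simp add: C_def sum_nonneg)
  obtain M :: nat where M: "C / (e / 2) < real M"
    using reals_Archimedean2 by blast
  have "norm (average g t) < e" if "t \<ge> Suc M" for t
  proof -
    have "norm (\<Sum>m=1..t. g m) \<le> (\<Sum>m=1..t. norm (g m))"
      by (rule norm_sum)
    also have "\<dots> \<le> (\<Sum>m=1..t. e / 2 + (if m \<in> {1..N} then norm (g m) else 0))"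
      using N \<open>e > 0\<close> by (intro sum_mono) (auto simp: less_imp_le)
    also have "\<dots> = real t * (e / 2) + (\<Sum>m\<in>{1..t} \<inter> {1..N}. norm (g m))"
      by (subst sum.inter_restrict) (simp_all only: finite_atLeastAtMost sum.distrib sum_constant card_atLeastAtMost diff_Suc_1)
    also have "\<dots> \<le> real t * (e / 2) + C"
      unfolding C_def by (intro add_left_mono sum_mono2) auto
    also have "C < real t * (e / 2)"
    proof -
      have "C / (e / 2) < real t" using M that by simp
      then show ?thesis using \<open>e > 0\<close> by (simp add: field_simps)
    qed
    finally have "norm (\<Sum>m=1..t. g m) < real t * e"
      by (simp add: mult.commute)
    then show ?thesis
      using that by (simp add: average_def field_simps)
  qed
  then show "\<exists>no. \<forall>t\<ge>no. norm (average g t - 0) < e"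
    by auto
qed

text \<open>Consecutive averages recover the newest term: g(t+1)/(t+1) is the average at t+1 minus
  t/(t+1) times the average at t, a difference of two sequences with the same limit.\<close>

lemma convergent_average_imp_sublinear:
  assumes "convergent (average g)"
  shows "sublinear g"
proof -
  from assms obtain L where L: "average g \<longlonglongrightarrow> L"
    by (auto simp: convergent_def)
  have "(\<lambda>t. average g (Suc t) - (real t / real (Suc t)) *\<^sub>R average g t) \<longlonglongrightarrow> L - 1 *\<^sub>R L"
    by (intro tendsto_diff tendsto_scaleR LIMSEQ_Suc[of "average g"] L LIMSEQ_n_over_Suc_n)
  also have "(\<lambda>t. average g (Suc t) - (real t / real (Suc t)) *\<^sub>R average g t) =
      (\<lambda>t. (1 / real (Suc t)) *\<^sub>R g (Suc t))"
    by (rule ext, case_tac t) (simp_all add: average_def scaleR_add_right)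
  finally have "(\<lambda>t. (1 / real (Suc t)) *\<^sub>R g (Suc t)) \<longlonglongrightarrow> 0"
    by simp
  then show ?thesis
    unfolding sublinear_def by (rule LIMSEQ_imp_Suc)
qed

text \<open>Joins the two properties that the theorem compares, so that tameness of a sublinear
  sampling sequence yields both implications.\<close>

definition tame :: "(nat \<Rightarrow> 'a::real_normed_vector) \<Rightarrow> bool"
  where "tame g \<longleftrightarrow> Bseq g \<and> convergent (average g)"

lemma tame_add:
  assumes "tame g" "tame h"
  shows "tame (\<lambda>t. g t + h t)"
proof -
  from assms obtain K L where "\<And>t. norm (g t) \<le> K" "\<And>t. norm (h t) \<le> L"
    unfolding tame_def Bseq_def by blast
  then have "Bseq (\<lambda>t. g t + h t)"
    by (intro BseqI'[of _ "K + L"]) (meson norm_add_rule_thm)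
  with assms show ?thesis
    by (simp add: tame_def average_add[abs_def] convergent_add)
qed

lemma tame_null:
  assumes "g \<longlonglongrightarrow> 0"
  shows "tame g"
  unfolding tame_def
  using convergentI[OF assms, THEN convergent_imp_Bseq] convergentI[OF average_null[OF assms]] by blast

section \<open>Sequences annihilated by a power of one linear factor\<close>

lemma perturbed_contraction_null:
  fixes x e :: "nat \<Rightarrow> real"
  assumes "0 \<le> r" "r < 1" and nonneg: "\<And>t. 0 \<le> x t"
    and step: "\<And>t. x (Suc t) \<le> r * x t + e t" and e: "e \<longlonglongrightarrow> 0"
  shows "x \<longlonglongrightarrow> 0"
proof (rule LIMSEQ_I)
  fix d :: real
  assume "d > 0"
  \<comment> \<open>The error threshold makes d / 2 the fixed point of y -> r y + (1 - r) d / 2; the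
    excess over d / 2 then decays geometrically.\<close>
  then have "(1 - r) * (d / 2) > 0"
    using \<open>r < 1\<close> by simp
  from LIMSEQ_D[OF e this] obtain N
    where N: "\<And>t. t \<ge> N \<Longrightarrow> e t < (1 - r) * (d / 2)"
    by (metis diff_zero real_norm_def abs_less_iff)
  have bound: "x (N + k) \<le> r ^ k * x N + d / 2" for k
  proof (induction k)
    case (Suc k)
    have "x (N + Suc k) \<le> r * x (N + k) + e (N + k)"
      using step by simp
    also have "\<dots> \<le> r * (r ^ k * x N + d / 2) + (1 - r) * (d / 2)"
      using Suc N[of "N + k"] \<open>0 \<le> r\<close> by (intro add_mono mult_left_mono) auto
    also have "\<dots> = r ^ Suc k * x N + d / 2"
      by (simp add: field_simps)
    finally show ?case .
  qed (use \<open>d > 0\<close> in simp)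
  have "(\<lambda>k. r ^ k * x N) \<longlonglongrightarrow> 0"
    using assms by (intro tendsto_mult_left_zero LIMSEQ_power_zero) auto
  from LIMSEQ_D[OF this, of "d / 2"] \<open>d > 0\<close> obtain K
    where K: "\<And>k. k \<ge> K \<Longrightarrow> \<bar>r ^ k * x N\<bar> < d / 2"
    by auto
  have "norm (x t - 0) < d" if "t \<ge> N + K" for t
  proof -
    have "x t \<le> r ^ (t - N) * x N + d / 2"
      using bound[of "t - N"] that by simp
    moreover have "\<bar>r ^ (t - N) * x N\<bar> < d / 2"
      using that by (intro K) simp
    ultimately show ?thesis
      using nonneg[of t] by simp
  qed
  then show "\<exists>no. \<forall>t\<ge>no. norm (x t - 0) < d"
    by blast
qed

text \<open>Applying one factor S - a leaves a sequence u that the remaining k factors annihilate,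
  hence a null sequence; then g(t+1) = a g(t) + u(t) is a contraction with vanishing error.\<close>

lemma power_root_null:
  fixes g :: "nat \<Rightarrow> 'a::complex_normed_vector"
  assumes "cmod a < 1" "\<And>t. poly_shift ([:-a, 1:] ^ k) g t = 0"
  shows "g \<longlonglongrightarrow> 0"
  using assms(2)
proof (induction k arbitrary: g)
  case (Suc k)
  define u where "u = poly_shift [:-a, 1:] g"
  have "u \<longlonglongrightarrow> 0"
    using Suc.prems unfolding u_def
    by (intro Suc.IH) (simp only: power_Suc2 poly_shift_mult)
  have "norm (g (Suc t)) \<le> cmod a * norm (g t) + norm (u t)" for t
  proof -
    have "g (Suc t) = a *\<^sub>C g t + u t"
      by (simp add: u_def)
    then show ?thesis
      using norm_triangle_ineq[of "a *\<^sub>C g t" "u t"] by (simp add: norm_scaleC)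
  qed
  then have "(\<lambda>t. norm (g t)) \<longlonglongrightarrow> 0"
    by (rule perturbed_contraction_null[OF norm_ge_zero assms(1) norm_ge_zero _
          tendsto_norm_zero[OF \<open>u \<longlonglongrightarrow> 0\<close>]])
  then show ?case
    by (rule tendsto_norm_zero_cancel)
qed (simp add: tendsto_eventually)

lemma root_geometric:
  assumes "\<And>t. poly_shift [:-a, 1:] g t = 0"
  shows "g t = a ^ t *\<^sub>C g 0"
proof (induction t)
  case (Suc t)
  have "g (Suc t) = a *\<^sub>C g t"
    using assms[of t] by simp
  with Suc show ?case
    by (simp add: scaleC_scaleC)
qed simp

text \<open>A double root $a$ would contribute a term $t a^{t-1} c$, which is sublinear only if $c = 0$.\<close>

lemma sublinear_double_root:
  fixes g :: "nat \<Rightarrow> 'a::complex_normed_vector"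
  assumes "cmod a \<ge> 1" "sublinear g" "\<And>t. poly_shift ([:-a, 1:] ^ 2) g t = 0"
  shows "poly_shift [:-a, 1:] g t = 0"
proof -
  define u where "u = poly_shift [:-a, 1:] g"
  have "poly_shift [:-a, 1:] u t = 0" for t
    using assms(3)[of t] unfolding u_def by (simp only: power2_eq_square poly_shift_mult)
  then have u: "u t = a ^ t *\<^sub>C u 0" for t
    by (rule root_geometric)
  \<comment> \<open>Multiplying by a turns t a^(t-1) into t a^t and avoids the exponent t - 1 at t =
    0.\<close>
  have g: "a *\<^sub>C g t = a ^ t *\<^sub>C (a *\<^sub>C g 0 + real t *\<^sub>R u 0)" for t
  proof (induction t)
    case (Suc t)
    have "g (Suc t) = a *\<^sub>C g t + u t"
      by (simp add: u_def)
    also have "\<dots> = a ^ t *\<^sub>C (a *\<^sub>C g 0 + real t *\<^sub>R u 0) + a ^ t *\<^sub>C u 0"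
      by (simp only: Suc u[of t])
    also have "\<dots> = a ^ t *\<^sub>C (a *\<^sub>C g 0 + real (Suc t) *\<^sub>R u 0)"
      by (simp add: scaleC_add_right algebra_simps)
    finally show ?case
      by (simp add: scaleC_scaleC)
  qed simp
  \<comment> \<open>Since |a|^t >= 1, the bracket is bounded in norm by a g(t), so its quotient by t
    tends to 0; yet that quotient tends to u(0).\<close>
  have "norm ((1 / real t) *\<^sub>R (a *\<^sub>C g 0 + real t *\<^sub>R u 0)) \<le> norm ((1 / real t) *\<^sub>R a *\<^sub>C g t)" for t
    unfolding g[of t] norm_scaleR norm_scaleC norm_power
    using mult_right_mono[OF one_le_power[OF assms(1)], of "norm (a *\<^sub>C g 0 + real t *\<^sub>R u 0)" t]
    by (intro mult_left_mono) simp_all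
  then have "(\<lambda>t. (1 / real t) *\<^sub>R (a *\<^sub>C g 0 + real t *\<^sub>R u 0)) \<longlonglongrightarrow> 0"
    by (intro tendsto_0_le[OF sublinear_scaleC[OF assms(2), of a, unfolded sublinear_def], of _ 1]
        always_eventually allI) (simp only: mult_1_right)
  moreover have "(\<lambda>t. (1 / real t) *\<^sub>R (a *\<^sub>C g 0 + real t *\<^sub>R u 0)) \<longlonglongrightarrow> 0 *\<^sub>R (a *\<^sub>C g 0) + u 0"
  \<comment> \<open>As \<open>1 / real 0\<close> is 0, the two expressions may differ at t = 0,
    where only the first keeps u(0).\<close>
  proof (rule Lim_transform_eventually)
    show "(\<lambda>t. (1 / real t) *\<^sub>R (a *\<^sub>C g 0) + u 0) \<longlonglongrightarrow> 0 *\<^sub>R (a *\<^sub>C g 0) + u 0"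
      by (intro tendsto_intros lim_1_over_n)
    show "\<forall>\<^sub>F t in sequentially. (1 / real t) *\<^sub>R (a *\<^sub>C g 0) + u 0 =
        (1 / real t) *\<^sub>R (a *\<^sub>C g 0 + real t *\<^sub>R u 0)"
      using eventually_gt_at_top[of 0] by eventually_elim (simp add: scaleR_add_right)
  qed
  ultimately have "0 = 0 *\<^sub>R (a *\<^sub>C g 0) + u 0"
    by (rule LIMSEQ_unique)
  then have "u 0 = 0"
    by simp
  then show ?thesis
    using u[of t] by (simp only: u_def complex_vector.scale_zero_right)
qed

text \<open>(S - a) g is again sublinear and annihilated by one factor fewer, so the induction
  hypothesis gives (S - a)^2 g = 0, and \<open>sublinear_double_root\<close> removes the second
  factor.\<close>

lemma sublinear_power_root:
  fixes g :: "nat \<Rightarrow> 'a::complex_normed_vector"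
  assumes "cmod a \<ge> 1" "sublinear g" "\<And>t. poly_shift ([:-a, 1:] ^ k) g t = 0"
  shows "poly_shift [:-a, 1:] g t = 0"
  using assms(2,3)
proof (induction k arbitrary: g t)
  case 0
  then have "g = (\<lambda>_. 0)" by auto
  then show ?case by simp
next
  case (Suc k)
  define u where "u = poly_shift [:-a, 1:] g"
  have "poly_shift [:-a, 1:] u t = 0" for t
    using Suc.prems unfolding u_def
    by (intro Suc.IH sublinear_poly_shift) (simp_all only: power_Suc2 poly_shift_mult)
  then have "poly_shift ([:-a, 1:] ^ 2) g t = 0" for t
    by (simp only: power2_eq_square poly_shift_mult u_def)
  then show ?case
    using sublinear_double_root assms(1) Suc.prems(1) by blast
qed

text \<open>For a = 1 the averages equal c from t = 1 on. Otherwise the geometric sum formula bounds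
  the partial sums, and division by t makes the averages tend to 0.\<close>

lemma tame_geometric:
  fixes c :: "'a::complex_normed_vector"
  assumes "cmod a = 1"
  shows "tame (\<lambda>t. a ^ t *\<^sub>C c)"
proof -
  have B: "Bseq (\<lambda>t. a ^ t *\<^sub>C c)"
    by (rule BseqI'[of _ "norm c"]) (simp add: norm_scaleC norm_power assms)
  have "convergent (average (\<lambda>t. a ^ t *\<^sub>C c))"
  proof (cases "a = 1")
    case True
    have "average (\<lambda>t. a ^ t *\<^sub>C c) (Suc t) = c" for t
      by (simp add: average_def True sum_constant_scaleR del: of_nat_Suc)
    then show ?thesis
      by (intro convergentI[of _ c] LIMSEQ_imp_Suc[of "average _"]) simp
  next
    case False
    have "norm (\<Sum>m=1..t. a ^ m *\<^sub>C c) \<le> 2 / cmod (a - 1) * norm c" for t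
    proof -
      have "(\<Sum>m=1..t. a ^ m *\<^sub>C c) = (\<Sum>m=1..t. a ^ m) *\<^sub>C c"
        by (rule complex_vector.scale_sum_left[symmetric])
      moreover have "(a - 1) * (\<Sum>m=1..t. a ^ m) = a ^ Suc t - a"
        by (induction t) (simp_all add: algebra_simps)
      then have "(\<Sum>m=1..t. a ^ m) = (a ^ Suc t - a) / (a - 1)"
        using False by (simp add: field_simps)
      moreover have "cmod (a ^ Suc t - a) \<le> 2"
        using norm_triangle_ineq4[of "a ^ Suc t" a] by (simp add: norm_mult norm_power assms)
      ultimately show ?thesis
        by (simp add: norm_scaleC norm_divide divide_right_mono mult_right_mono)
    qed
    then have "Bseq (\<lambda>t. \<Sum>m=1..t. a ^ m *\<^sub>C c)"
      by (rule BseqI')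
    from Bseq_imp_sublinear[OF this] show ?thesis
      by (intro convergentI[of _ 0]) (simp add: sublinear_def average_def[abs_def])
  qed
  with B show ?thesis
    by (simp add: tame_def)
qed

lemma sublinear_power_root_tame:
  fixes g :: "nat \<Rightarrow> 'a::complex_normed_vector"
  assumes "sublinear g" "\<And>t. poly_shift ([:-a, 1:] ^ k) g t = 0"
  shows "tame g"
proof -
  consider "cmod a < 1" | "cmod a = 1" | "cmod a > 1" by linarith
  then show ?thesis
  proof cases
    case 1
    then show ?thesis
      using assms by (blast intro: tame_null power_root_null)
  next
    case 2
    then have "poly_shift [:-a, 1:] g t = 0" for t
      using sublinear_power_root[of a g k] assms by simp
    then have "g = (\<lambda>t. a ^ t *\<^sub>C g 0)"
      using root_geometric by blast
    then show ?thesis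
      using tame_geometric[OF 2, of "g 0"] by metis
  next
    case 3
    then have "poly_shift [:-a, 1:] g t = 0" for t
      using sublinear_power_root[of a g k] assms by simp
    then have g: "g t = a ^ t *\<^sub>C g 0" for t
      by (rule root_geometric)
    have inv: "1 / cmod a < 1"
      using 3 by (subst divide_less_eq_1_pos) linarith+
    \<comment> \<open>Both factors on the right tend to 0, the first because exponential decay beats
      t, the second by sublinearity; so g(0) must vanish.\<close>
    have "norm (g 0) = (real t * (1 / cmod a) ^ t) * norm ((1 / real t) *\<^sub>R g t)" if "t > 0" for t
    proof -
      have "norm (g t) = cmod a ^ t * norm (g 0)"
        by (simp only: g[of t] norm_scaleC norm_power)
      moreover have "a \<noteq> 0"
        using 3 by auto
      ultimately show ?thesis
        using that by (simp add: power_one_over field_simps)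
    qed
    then have "\<forall>\<^sub>F t in sequentially.
        (real t * (1 / cmod a) ^ t) * norm ((1 / real t) *\<^sub>R g t) = norm (g 0)"
      by (intro eventually_mono[OF eventually_gt_at_top[of 0]]) (rule sym)
    moreover have "(\<lambda>t. (real t * (1 / cmod a) ^ t) * norm ((1 / real t) *\<^sub>R g t)) \<longlonglongrightarrow> 0 * 0"
      using assms(1) unfolding sublinear_def
      by (intro tendsto_mult powser_times_n_limit_0 tendsto_norm_zero) (use inv in simp_all)
    ultimately have "(\<lambda>t. norm (g 0)) \<longlonglongrightarrow> 0"
      by (simp add: Lim_transform_eventually)
    then have "g 0 = 0"
      by (simp add: LIMSEQ_const_iff)
    then have "g t = 0" for t
      by (subst g) simp
    then have "g = (\<lambda>t. 0)"
      by blast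
    then show ?thesis
      by (simp add: tame_null)
  qed
qed

section \<open>Splitting a recurrent sequence at one root\<close>

text \<open>Induction on k, with L = x - a: in 1 = u' L^k + v' q the first summand is multiplied by
  1 = v q - L w, which raises the power of L by one.\<close>

lemma bezout_linear_power:
  fixes q :: "'a::field poly"
  assumes "poly q a \<noteq> 0"
  shows "\<exists>u v. u * [:-a, 1:] ^ k + v * q = 1"
proof -
  define c where "c = poly q a"
  \<comment> \<open>The inverse of q(a), so that v q - 1 vanishes at a and is divisible by the
    linear factor.\<close>
  define v where "v = [:1 / c:]"
  have "[:-a, 1:] dvd v * q - 1"
    using assms by (simp add: poly_eq_0_iff_dvd[symmetric] v_def c_def)
  then obtain w where w: "v * q - 1 = [:-a, 1:] * w"
    by (auto elim: dvdE)
  show ?thesis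
  proof (induction k)
    case 0
    show ?case
      by (intro exI[of _ 1] exI[of _ 0]) simp
  next
    case (Suc k)
    then obtain u' v' where k: "u' * [:-a, 1:] ^ k + v' * q = 1"
      by blast
    have "1 = (u' * [:-a, 1:] ^ k) * (v * q - [:-a, 1:] * w) + v' * q"
      using k by (simp only: w[symmetric]) simp
    also have "\<dots> = (- u' * w) * [:-a, 1:] ^ Suc k + (u' * [:-a, 1:] ^ k * v + v') * q"
      by (simp only: power_Suc minus_mult_left[symmetric]) (simp only: algebra_simps add.right_inverse add_0_right add_0_left diff_self)
    finally show ?case
      by metis
  qed
qed

lemma sublinear_recurrence_tame:
  fixes g :: "nat \<Rightarrow> 'a::complex_normed_vector"
  assumes "p \<noteq> 0" "sublinear g" "\<And>t. poly_shift p g t = 0"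
  shows "tame g"
  using assms
proof (induction "degree p" arbitrary: p g rule: less_induct)
  case less
  show ?case
  proof (cases "degree p = 0")
    case True
    then obtain c where "p = [:c:]" "c \<noteq> 0"
      using less.prems(1) by (metis degree_eq_zeroE pCons_eq_0_iff)
    then have "g = (\<lambda>_. 0)"
      using less.prems(3) by (auto)
    then show ?thesis
      by (simp add: tame_null)
  next
    case False
    then obtain a where a: "poly p a = 0"
      using fundamental_theorem_of_algebra[of p] by (auto simp: constant_degree)
    \<comment> \<open>Extracting the full multiplicity leaves q(a) nonzero, as the Bezout identity
      requires; k > 0 makes the degree of q smaller.\<close>
    define k where "k = order a p"
    obtain q where q: "p = [:-a, 1:] ^ k * q" "\<not> [:-a, 1:] dvd q"
      using order_decomp[OF less.prems(1)] unfolding k_def by blast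
    have "k \<noteq> 0"
      using a less.prems(1) by (simp add: k_def order_root)
    have "q \<noteq> 0"
      using q(2) by auto
    have "degree q < degree p"
      using \<open>q \<noteq> 0\<close> \<open>k \<noteq> 0\<close> by (simp add: q(1) degree_mult_eq degree_linear_power)
    obtain u v where uv: "u * [:-a, 1:] ^ k + v * q = 1"
      using bezout_linear_power q(2) poly_eq_0_iff_dvd by blast
    \<comment> \<open>Each part is annihilated by the complementary factor, since (x - a)^k v q and
      q u (x - a)^k are multiples of p. So \<open>g1\<close> involves a single root, and
      \<open>g2\<close> falls under the induction hypothesis.\<close>
    define g1 where "g1 = poly_shift (v * q) g"
    define g2 where "g2 = poly_shift (u * [:-a, 1:] ^ k) g"
    have kill: "poly_shift (r * p) g t = 0" for r t
      by (simp add: poly_shift_mult poly_shift_seq_0 less.prems(3))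
    have "poly_shift ([:-a, 1:] ^ k) g1 t = 0" for t
      using kill[of v t] by (simp only: g1_def q(1) poly_shift_mult[symmetric] mult_ac)
    then have "tame g1"
      unfolding g1_def by (intro sublinear_power_root_tame sublinear_poly_shift less.prems(2))
    moreover have "poly_shift q g2 t = 0" for t
      using kill[of u t] by (simp only: g2_def q(1) poly_shift_mult[symmetric] mult_ac)
    then have "tame g2"
      using less.hyps[OF \<open>degree q < degree p\<close> \<open>q \<noteq> 0\<close>] sublinear_poly_shift[OF less.prems(2)]
      by (simp add: g2_def)
    moreover have "g = (\<lambda>t. g2 t + g1 t)"
      by (simp only: g1_def g2_def poly_shift_add[symmetric] uv poly_shift_1)
    ultimately show ?thesis
      using tame_add by metis
  qed
qed

section \<open>Recurrences from finite dimension\<close>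

text \<open>Serves twice: with the operator of an evolution to advance a recurrence in time, and
  with the sampling function to pass it to the sampling values.\<close>

lemma clinear_poly_shift:
  assumes "clinear f"
  shows "poly_shift p (\<lambda>t. f (g t)) t = f (poly_shift p g t)"
proof -
  interpret f: Vector_Spaces.linear scaleC scaleC f
    by (rule assms)
  show ?thesis
    by (simp add: poly_shift_def f.sum f.scale)
qed

text \<open>The \<open>card B + 1\<close> vectors x 0, ..., x (card B) satisfy a linear relation,
  whose coefficients form p. Dependence is a notion for sets, so a repetition among them is treated
  apart, by a difference of two monomials.\<close>

lemma finite_dim_annihilator:
  fixes x :: "nat \<Rightarrow> 'a::complex_vector"
  assumes "finite B" "range x \<subseteq> cspan B"
  obtains p where "p \<noteq> 0" "poly_shift p x 0 = 0"
proof (cases "inj_on x {..card B}")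
  case False
  then obtain i j where ij: "i \<noteq> j" "x i = x j"
    by (auto simp: inj_on_def)
  have monom: "poly_shift (monom 1 n) x 0 = x n" for n
  proof -
    have "poly_shift (monom 1 n) x 0 = (\<Sum>i\<le>n. if i = n then x n else 0)"
      unfolding poly_shift_def by (intro sum.cong) (auto simp: degree_monom_eq)
    then show ?thesis by simp
  qed
  have "poly_shift (monom 1 i + smult (- 1) (monom 1 j)) x 0 = 0"
    by (simp only: poly_shift_add poly_shift_smult monom ij) simp
  moreover have "coeff (monom 1 i + smult (- 1) (monom 1 j)) i \<noteq> (0 :: complex)"
    using ij(1) by simp
  then have "monom 1 i + smult (- 1) (monom 1 j) \<noteq> (0 :: complex poly)"
    by (metis coeff_0)
  ultimately show thesis
    using that by blast
next
  case True
  define S where "S = x ` {..card B}"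
  have "finite S" "card S = Suc (card B)"
    using True by (simp_all add: S_def card_image)
  moreover have "S \<subseteq> cspan B"
    using assms(2) by (auto simp: S_def)
  ultimately have "complex_vector.dependent S"
    using complex_vector.independent_span_bound[OF assms(1), of S] by force
  then obtain c where c: "\<exists>y\<in>S. c y \<noteq> 0" "(\<Sum>y\<in>S. c y *\<^sub>C y) = 0"
    using complex_vector.dependent_finite[OF \<open>finite S\<close>] by blast
  define p where "p = Poly (map (\<lambda>i. c (x i)) [0..<Suc (card B)])"
  have coeff_p: "coeff p i = (if i \<le> card B then c (x i) else 0)" for i
    by (simp add: p_def nth_default_def del: upt_Suc)
  have "p \<noteq> 0"
  proof
    assume "p = 0"
    then have "c (x i) = 0" if "i \<le> card B" for i
      using coeff_p[of i] that by simp
    then show False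
      using c(1) by (auto simp: S_def)
  qed
  have "degree p \<le> card B"
    by (rule degree_le) (simp add: coeff_p)
  then have "poly_shift p x 0 = (\<Sum>i\<le>card B. coeff p i *\<^sub>C x i)"
    unfolding poly_shift_def add_0 by (intro sum.mono_neutral_left) (auto simp: coeff_eq_0)
  also have "\<dots> = (\<Sum>y\<in>S. c y *\<^sub>C y)"
    unfolding S_def by (subst sum.reindex[OF True]) (simp add: coeff_p)
  finally have "poly_shift p x 0 = 0"
    using c(2) by simp
  with \<open>p \<noteq> 0\<close> show thesis
    using that by blast
qed

text \<open>The relation at time 0 is carried to every later time by the operator, which advances
  the orbit and commutes with polynomials in the shift.\<close>

lemma finite_dim_evolution_recurrence:
  assumes "finite_dim_evolution \<Phi>"
  obtains p where "p \<noteq> 0" "\<And>t. poly_shift p (orbit \<Phi>) t = 0"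
proof -
  interpret Vector_Spaces.linear scaleC scaleC "fst \<Phi>"
    using assms by (simp add: finite_dim_evolution_def is_evolution_def)
  obtain B where "finite B" "cspan B = cspan {orbit \<Phi> t |t. t \<ge> 0}"
    using assms by (auto simp: finite_dim_evolution_def finite_dim_subspace_def)
  then have "range (orbit \<Phi>) \<subseteq> cspan B"
    by (auto intro!: complex_vector.span_base)
  from finite_dim_annihilator[OF \<open>finite B\<close> this] obtain p
    where p: "p \<noteq> 0" "poly_shift p (orbit \<Phi>) 0 = 0" .
  have "poly_shift p (orbit \<Phi>) t = 0" for t
  proof (induction t)
    case (Suc t)
    have "poly_shift p (orbit \<Phi>) (Suc t) = poly_shift p (\<lambda>t. fst \<Phi> (orbit \<Phi> t)) t"
      by (simp add: poly_shift_def orbit_def)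
    also have "\<dots> = fst \<Phi> (poly_shift p (orbit \<Phi>) t)"
      by (rule clinear_poly_shift) unfold_locales
    finally show ?case
      using Suc zero by simp
  qed (rule p)
  with p(1) show thesis
    using that by blast
qed

theorem theorem3:
  fixes \<psi> :: "'u::complex_banach \<Rightarrow> 'u"
    and s :: 'u
    and f :: "'u \<Rightarrow> 'f::complex_normed_vector"
  assumes "finitary (\<psi>, s)"
    and "sampling_function f"
  shows "convergent (sampling_average f (\<psi>, s)) \<longleftrightarrow>
    bounded {sampling_value f (\<psi>, s) t |t. t \<ge> 1}"
proof -
  interpret f: Vector_Spaces.linear scaleC scaleC f
    using assms(2) by (simp add: sampling_function_def)
  obtain \<Phi> where \<Phi>: "finite_dim_evolution \<Phi>" "equivalent (\<psi>, s) \<Phi>"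
    using assms(1) by (auto simp: finitary_def)
  define x where "x = sampling_value f (\<psi>, s)"
  define y where "y = sampling_value f \<Phi>"
  from finite_dim_evolution_recurrence[OF \<Phi>(1)] obtain p
    where "p \<noteq> 0" "\<And>t. poly_shift p (orbit \<Phi>) t = 0"
    by blast
  then have p: "p \<noteq> 0" "\<And>t. poly_shift p y t = 0"
    using clinear_poly_shift[OF f.linear_axioms, of p "orbit \<Phi>"]
    by (simp_all add: y_def sampling_value_def[abs_def] f.zero)
  have "(\<lambda>t. orbit \<Phi> t - orbit (\<psi>, s) t) \<longlonglongrightarrow> 0"
    using \<Phi>(2) by (simp add: equivalent_def tendsto_norm_zero_iff)
  \<comment> \<open>By linearity the sample of a difference is the difference of samples, so
    continuity of \<open>f\<close> transfers the equivalence to the sampling values.\<close>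
  then have "(\<lambda>t. f (orbit \<Phi> t - orbit (\<psi>, s) t)) \<longlonglongrightarrow> f 0"
    using assms(2) by (intro continuous_on_tendsto_compose[of UNIV f]) (auto simp: sampling_function_def)
  then have diff: "(\<lambda>t. y t - x t) \<longlonglongrightarrow> 0"
    by (simp add: x_def y_def sampling_value_def f.diff f.zero)
  have diff': "(\<lambda>t. x t - y t) \<longlonglongrightarrow> 0"
    using tendsto_minus[OF diff] by simp
  \<comment> \<open>Sublinearity passes from x to y, the recurrence makes y tame, and tameness
    returns to x, since the two differ by a null sequence.\<close>
  have tame: "tame x" if "sublinear x"
  proof -
    have "sublinear (\<lambda>t. x t + (y t - x t))"
      using that diff tame_null Bseq_imp_sublinear unfolding tame_def
      by (intro sublinear_add) blast+
    then have "tame y"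
      using sublinear_recurrence_tame[OF p(1) _ p(2)] by simp
    from tame_add[OF this tame_null[OF diff']] show ?thesis
      by simp
  qed
  have average: "sampling_average f (\<psi>, s) = average x"
    by (simp add: sampling_average_def[abs_def] average_def[abs_def] x_def)
  \<comment> \<open>The bounded set starts at t = 1, whereas \<open>Bseq\<close> includes t = 0; the
    maximum with the norm of x(0) accounts for it.\<close>
  have Bseq: "Bseq x" if "bounded {x t |t. t \<ge> 1}"
  proof -
    from that obtain K where K: "\<And>t. t \<ge> 1 \<Longrightarrow> norm (x t) \<le> K"
      by (auto simp: bounded_iff)
    then have "norm (x t) \<le> max K (norm (x 0))" for t
      by (cases t) (auto simp: le_max_iff_disj)
    then show ?thesis
      by (rule BseqI')
  qed
  show ?thesis
  proof
    assume "convergent (sampling_average f (\<psi>, s))"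
    then have "Bseq x"
      using tame convergent_average_imp_sublinear unfolding average tame_def by blast
    then show "bounded {sampling_value f (\<psi>, s) t |t. t \<ge> 1}"
      unfolding x_def by (auto simp: Bseq_def bounded_iff)
  next
    assume "bounded {sampling_value f (\<psi>, s) t |t. t \<ge> 1}"
    then show "convergent (sampling_average f (\<psi>, s))"
      using Bseq tame Bseq_imp_sublinear unfolding average tame_def x_def by blast
  qed
qed

end
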